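(* Let $n\geq 2$ be an integer. (1) If $n\not\equiv 0\pmod 3$, then for every prime power $q\geq 2$ there exists a scattered $\mathbb{F}_q$-linear set of rank $3n$ in $PG(2,q^{2n})$. (2) If $n\equiv 0\pmod 3$, then for every prime power $q\equiv 1\pmod 3$ there exists a scattered $\mathbb{F}_q$-linear set of rank $3n$ in $PG(2,q^{2n})$.
   Context: For an $\mathbb{F}_q$-subspace $U$ of $\mathbb{F}_{q^{2n}}^3$ of $\mathbb{F}_q$-dimension $k$, $L_U=\{\langle u\rangle_{\mathbb{F}_{q^{2n}}}: u\in U\setminus\{0\}\}\subseteq PG(2,q^{2n})$ is an $\mathbb{F}_q$-linear set of rank $k$; it is scattered if every point $\langle v\rangle$ of $L_U$ satisfies $\dim_{\mathbb{F}_q}(U\cap\langle v\rangle_{\mathbb{F}_{q^{2n}}})=1$. *)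

theory Defs
  imports "HOL-Analysis.Cartesian_Space" "HOL-Number_Theory.Number_Theory"
begin

text \<open>The inclusion of \<open>F\<^sub>q\<close> in \<open>F\<^bsub>q^(2n)\<^esub>\<close> is rendered by a unital ring homomorphism
  \<open>\<iota>\<close> from a field type \<open>'q\<close> of order \<open>q\<close> to a field type \<open>'a\<close> of order \<open>q^(2n)\<close>, so that the
  library's \<open>subspace\<close> and \<open>dim\<close> apply to \<open>F\<^sub>q\<close>-subspaces of \<open>'a ^ 3\<close>.\<close>

definition field_embedding :: "('q::field \<Rightarrow> 'a::field) \<Rightarrow> bool" where
  "field_embedding \<iota> \<longleftrightarrow>
     \<iota> 1 = 1 \<and> (\<forall>x y. \<iota> (x + y) = \<iota> x + \<iota> y) \<and> (\<forall>x y. \<iota> (x * y) = \<iota> x * \<iota> y)"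

definition sub_scale :: "('q::field \<Rightarrow> 'a::field) \<Rightarrow> 'q \<Rightarrow> 'a ^ 3 \<Rightarrow> 'a ^ 3" where
  "sub_scale \<iota> c v = \<iota> c *s v"

lemma vector_space_sub_scale:
  assumes "field_embedding \<iota>"
  shows "vector_space (sub_scale \<iota>)"
  using assms unfolding field_embedding_def sub_scale_def
  by unfold_locales (simp_all add: vector_add_ldistrib vector_sadd_rdistrib vector_smult_assoc)

text \<open>Points of \<open>PG(2, 'a)\<close> are the one-dimensional \<open>'a\<close>-subspaces of \<open>'a ^ 3\<close>; \<open>vec.span\<close> is the
  span over the large field \<open>'a\<close>.\<close>

definition linear_set :: "('a::field ^ 3) set \<Rightarrow> ('a ^ 3) set set" where
  "linear_set U = {vec.span {u} | u. u \<in> U - {0}}"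

definition scattered_linear_set ::
  "('q::field \<Rightarrow> 'a::field) \<Rightarrow> nat \<Rightarrow> ('a ^ 3) set set \<Rightarrow> bool" where
  "scattered_linear_set \<iota> k L \<longleftrightarrow>
     (\<exists>U. module.subspace (sub_scale \<iota>) U \<and> vector_space.dim (sub_scale \<iota>) U = k \<and>
          L = linear_set U \<and>
          (\<forall>P\<in>L. vector_space.dim (sub_scale \<iota>) (U \<inter> P) = 1))"

end

theory Submission
  imports Defs "HOL-Computational_Algebra.Polynomial"
begin

text \<open>Let \<open>K\<close> be the subfield of order \<open>q^n\<close>, let \<open>\<omega>\<close> be an element outside \<open>K\<close>, and let \<open>f\<close>
  be a map of \<open>K^3\<close> that is semilinear for \<open>x \<mapsto> x^q\<close>. The set \<open>U = {f x + \<omega> x | x \<in> K^3}\<close> has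
  rank \<open>3n\<close>. If \<open>(A + B \<omega>) u \<in> U\<close> for a nonzero \<open>u = f x + \<omega> x\<close>, then comparing coordinates with
  respect to \<open>1, \<omega>\<close> and applying \<open>f\<close> yields a relation between \<open>x\<close>, \<open>f x\<close> and \<open>f (f x)\<close> in which
  \<open>f (f x)\<close> has the coefficient \<open>B^q\<close>. Hence \<open>U\<close> is scattered as soon as \<open>f\<close> has no invariant
  subspace of dimension 1 or 2.

  One choice of \<open>f\<close> serves all \<open>n\<close>. Let \<open>p\<close> be a cubic over \<open>F\<^sub>q\<close> without roots in \<open>F\<^sub>q\<close>, identify
  \<open>K^3\<close> with \<open>K[t]/(p)\<close>, let \<open>\<sigma>\<close> be the \<open>q\<close>-th power map on coefficients, and take
  \<open>f z = (1 - b t) \<sigma> z\<close> with \<open>b \<in> K\<close>. The \<open>n\<close>-th iterate of \<open>f\<close> is multiplication by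
  \<open>\<nu> = (1 - b t) (1 - b^q t) \<dots> (1 - b^(q^(n-1)) t)\<close>, an element of the field \<open>F\<^sub>q[t]/(p)\<close>. The
  coefficient of \<open>t\<close> in \<open>\<nu>\<close> is a polynomial in \<open>b\<close> with linear term \<open>-b\<close> and degree less than
  \<open>q^n\<close>, so \<open>\<nu> \<notin> F\<^sub>q\<close> for some \<open>b \<in> K\<close>. A subspace invariant under \<open>f\<close> is then invariant under
  \<open>\<nu>\<close>, hence under \<open>F\<^sub>q(\<nu>) = F\<^sub>q[t]/(p)\<close>, hence under \<open>t\<close> and under \<open>\<sigma>\<close>. It is therefore an ideal
  generated by a divisor of \<open>p\<close> with coefficients in \<open>F\<^sub>q\<close>, and such an ideal is trivial.\<close>

section \<open>Finite fields and vector spaces over them\<close>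

lemma power_card_eq_self:
  fixes x :: "'a::{field,finite}"
  shows "x ^ CARD('a) = x"
proof (cases "x = 0")
  case False
  have "bij_betw (\<lambda>y. x * y) (UNIV - {0}) (UNIV - {0})"
    by (rule bij_betw_byWitness[where f' = "\<lambda>y. y / x"])
      (use False in \<open>auto simp: image_subset_iff\<close>)
  from prod.reindex_bij_betw[OF this, of "\<lambda>y. y"]
  have "x ^ card (UNIV - {0::'a}) = 1"
    by (simp add: prod.distrib)
  moreover have "CARD('a) = Suc (card (UNIV - {0::'a}))"
    by (rule card.remove) simp_all
  ultimately show ?thesis
    by (metis mult.right_neutral power_Suc)
qed simp

lemma primepow_power_add:
  fixes x y :: "'a::{field,finite}"
  assumes "primepow q" and "CARD('a) = q ^ m"
  shows "(x + y) ^ q = x ^ q + y ^ q"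
proof -
  obtain p k where p: "Factorial_Ring.prime p" and q: "q = p ^ k"
    using assms(1) by (auto simp: primepow_def)
  have prime_char: "Factorial_Ring.prime CHAR('a)"
    by (simp add: prime_CHAR_semidom finite_imp_CHAR_pos)
  have "CHAR('a) dvd p ^ (k * m)"
    using CHAR_dvd_CARD[where ?'a = 'a] by (simp add: assms(2) q power_mult)
  hence "CHAR('a) = p"
    using p prime_char by (metis prime_dvd_power primes_dvd_imp_eq)
  thus ?thesis
    using freshmans_dream'[OF prime_char, of q k] q by simp
qed

lemma card_power_eq_mult_le:
  fixes c :: "'a::idom"
  assumes "1 < Q"
  shows "card {x. x ^ Q = c * x} \<le> Q"
proof -
  define p where "p = monom 1 Q - monom c 1"
  have "poly.coeff p Q = 1"
    using assms by (simp add: p_def)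
  hence "p \<noteq> 0"
    by auto
  have "{x. x ^ Q = c * x} = {x. poly p x = 0}"
    by (simp add: p_def poly_monom)
  also have "card \<dots> \<le> degree p"
    using \<open>p \<noteq> 0\<close> by (rule card_poly_roots_bound)
  also have "degree p \<le> Q"
    unfolding p_def
    by (rule degree_diff_le) (use assms in \<open>auto intro: order.trans[OF degree_monom_le]\<close>)
  finally show ?thesis .
qed

definition fixed_field :: "nat \<Rightarrow> 'a::field set" where
  "fixed_field Q = {x. x ^ Q = x}"

lemma fixed_field_iff: "x \<in> fixed_field Q \<longleftrightarrow> x ^ Q = x"
  by (simp add: fixed_field_def)

lemma card_fixed_field_le: "1 < Q \<Longrightarrow> card (fixed_field Q :: 'a::field set) \<le> Q"
  using card_power_eq_mult_le[of Q "1 :: 'a"] by (simp add: fixed_field_def)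

text \<open>The fixed field is the kernel of the additive map \<open>x \<mapsto> x^Q - x\<close>, and the image of this map
  lies among the at most \<open>Q\<close> solutions of \<open>y^Q = - y\<close>.\<close>

lemma card_fixed_field_of_square:
  assumes "1 < Q" and card: "CARD('a) = Q\<^sup>2"
    and add: "\<And>x y :: 'a. (x + y) ^ Q = x ^ Q + y ^ Q"
  shows "card (fixed_field Q :: 'a::{field,finite} set) = Q"
proof -
  have diff: "(x - y) ^ Q = x ^ Q - y ^ Q" for x y :: 'a
    using add[of "x - y" y] by (simp add: algebra_simps)
  define h :: "'a \<Rightarrow> 'a" where "h x = x ^ Q - x" for x
  define g :: "'a \<Rightarrow> 'a \<times> 'a" where "g x = (h x, x - inv_into UNIV h (h x))" for x
  have "h x ^ Q = - 1 * h x" for x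
    using power_card_eq_self[of x] by (simp add: h_def diff card power2_eq_square power_mult)
  moreover have "x - inv_into UNIV h (h x) \<in> fixed_field Q" for x
    using f_inv_into_f[OF rangeI[of h x]]
    by (simp add: fixed_field_iff h_def diff algebra_simps)
  ultimately have "range g \<subseteq> {y. y ^ Q = - 1 * y} \<times> fixed_field Q"
    by (auto simp: g_def)
  hence "card (range g) \<le> card {y :: 'a. y ^ Q = - 1 * y} * card (fixed_field Q :: 'a set)"
    by (metis card_mono card_cartesian_product finite)
  moreover have "inj g"
    by (auto simp: inj_def g_def)
  ultimately have "Q\<^sup>2 \<le> card {y :: 'a. y ^ Q = - 1 * y} * card (fixed_field Q :: 'a set)"
    by (simp add: card_image card)
  also have "\<dots> \<le> Q * card (fixed_field Q :: 'a set)"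
    using assms(1) by (intro mult_le_mono1 card_power_eq_mult_le)
  finally have "Q \<le> card (fixed_field Q :: 'a set)"
    using assms(1) by (simp add: power2_eq_square)
  thus ?thesis
    using card_fixed_field_le[OF assms(1)] by (rule le_antisym[rotated])
qed

lemma (in vector_space) card_subspace_eq_power_dim:
  assumes "subspace S" and "finite S"
  shows "card S = card (UNIV :: 'a set) ^ dim S"
proof -
  obtain B where B: "B \<subseteq> S" "independent B" "S \<subseteq> span B" "card B = dim S"
    by (rule basis_exists)
  have "finite B"
    using B(1) assms(2) finite_subset by blast
  have S: "S = span B"
    using B assms(1) by (simp add: span_subspace)
  define F where "F u = (\<Sum>b\<in>B. scale (u b) b)" for u
  have "inj_on F (B \<rightarrow>\<^sub>E UNIV)"
  proof (rule inj_onI)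
    fix u v assume u: "u \<in> B \<rightarrow>\<^sub>E UNIV" and v: "v \<in> B \<rightarrow>\<^sub>E UNIV" and "F u = F v"
    hence "(\<Sum>b\<in>B. scale (u b - v b) b) = 0"
      by (simp add: F_def scale_left_diff_distrib sum_subtractf)
    hence "u b - v b = 0" if "b \<in> B" for b
      using independentD[OF B(2) \<open>finite B\<close> order_refl, of "\<lambda>b. u b - v b"] that by blast
    thus "u = v"
      using u v by (intro PiE_ext) auto
  qed
  moreover have "F ` (B \<rightarrow>\<^sub>E UNIV) = S"
  proof
    show "F ` (B \<rightarrow>\<^sub>E UNIV) \<subseteq> S"
      unfolding S F_def by (auto intro: span_sum span_scale span_base)
    show "S \<subseteq> F ` (B \<rightarrow>\<^sub>E UNIV)"
    proof
      fix x assume "x \<in> S"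
      then obtain u where "x = F u"
        unfolding S span_finite[OF \<open>finite B\<close>] F_def by blast
      hence "x = F (restrict u B)"
        by (simp add: F_def cong: sum.cong)
      thus "x \<in> F ` (B \<rightarrow>\<^sub>E UNIV)"
        by auto
    qed
  qed
  ultimately have "card S = card (B \<rightarrow>\<^sub>E (UNIV :: 'a set))"
    by (metis card_image)
  thus ?thesis
    by (simp add: card_PiE[OF \<open>finite B\<close>] B(4))
qed

lemma (in vector_space) mem_subspace_if_scale_mem:
  assumes "subspace W" and "scale k v \<in> W" and "k \<noteq> 0"
  shows "v \<in> W"
  using subspace_scale[OF assms(1,2), of "inverse k"] assms(3) by simp

lemma (in finite_dimensional_vector_space) inj_linear_image_subspace_eq:
  assumes h: "Vector_Spaces.linear scale scale h" "inj h" and W: "subspace W" "h ` W \<subseteq> W"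
  shows "h ` W = W"
proof (rule subspace_dim_equal)
  interpret h: Vector_Spaces.linear scale scale h
    by fact
  interpret finite_dimensional_vector_space_pair_1 scale Basis scale ..
  show "dim W \<le> dim (h ` W)"
    using dim_image_eq[OF h(1), of W] inj_on_subset[OF h(2)] by simp
  show "subspace (h ` W)"
    using W(1) by (rule h.subspace_image)
qed fact+

text \<open>Factorizations \<open>(x - a) (x\<^sup>2 - r x - s)\<close> and monic cubics are equinumerous, but
  \<open>x\<^sup>3 - x\<^sup>2\<close> has two factorizations.\<close>

lemma ex_cubic_without_root:
  "\<exists>c0 c1 c2 :: 'a::{comm_ring_1,finite}. \<forall>x. x ^ 3 \<noteq> c0 + c1 * x + c2 * x\<^sup>2"
proof (rule ccontr)
  assume all_have_roots: "\<not> ?thesis"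
  define expand :: "'a \<times> 'a \<times> 'a \<Rightarrow> 'a \<times> 'a \<times> 'a"
    where "expand = (\<lambda>(a, r, s). (- a * s, s - a * r, r + a))"
  have "surj expand"
    unfolding surj_def
  proof
    fix c :: "'a \<times> 'a \<times> 'a"
    obtain c0 c1 c2 where c: "c = (c0, c1, c2)"
      by (cases c)
    obtain a where a: "a ^ 3 = c0 + c1 * a + c2 * a\<^sup>2"
      using all_have_roots by blast
    have "c = expand (a, c2 - a, c1 + a * (c2 - a))"
      unfolding c expand_def using a by (simp add: algebra_simps power2_eq_square power3_eq_cube)
    thus "\<exists>x. c = expand x" ..
  qed
  hence "inj expand"
    by (simp add: finite_UNIV_surj_inj)
  moreover have "expand (0, 1, 0) = expand (1, 0, 0)"
    by (simp add: expand_def)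
  ultimately show False
    by (metis injD prod.inject zero_neq_one)
qed

lemma card_vec_components: "card {v :: 'a ^ 'n. \<forall>j. v $ j \<in> S} = card S ^ CARD('n::finite)"
proof -
  have "{v :: 'a ^ 'n. \<forall>j. v $ j \<in> S} = vec_lambda ` (UNIV \<rightarrow>\<^sub>E S)"
  proof (intro equalityI subsetI)
    fix v :: "'a ^ 'n" assume "v \<in> {v. \<forall>j. v $ j \<in> S}"
    hence "vec_nth v \<in> UNIV \<rightarrow>\<^sub>E S"
      by auto
    thus "v \<in> vec_lambda ` (UNIV \<rightarrow>\<^sub>E S)"
      by (metis image_eqI vec_nth_inverse)
  qed auto
  hence "card {v :: 'a ^ 'n. \<forall>j. v $ j \<in> S} = card ((UNIV :: 'n set) \<rightarrow>\<^sub>E S)"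
    by (simp add: card_image inj_on_def vec_lambda_inject)
  thus ?thesis
    by (simp add: card_PiE)
qed

definition vec_power :: "nat \<Rightarrow> 'a::monoid_mult ^ 'n \<Rightarrow> 'a ^ 'n" where
  "vec_power Q v = (\<chi> j. v $ j ^ Q)"

lemma vec_power_nth [simp]: "vec_power Q v $ j = v $ j ^ Q"
  by (simp add: vec_power_def)

lemma vec_power_vec_power: "vec_power P (vec_power Q v) = vec_power (Q * P) v"
  by (simp add: vec_eq_iff power_mult)

lemma vec_power_scale: "vec_power Q (k *s v) = k ^ Q *s vec_power Q v"
  for v :: "'a::comm_semiring_1 ^ 'n"
  by (simp add: vec_eq_iff power_mult_distrib)

locale frobenius_field =
  fixes q :: nat and field_type :: "'a::field itself"
  assumes q_gt_1: "1 < q"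
    and power_q_add: "\<And>x y :: 'a. (x + y) ^ q = x ^ q + y ^ q"
begin

lemma frobenius_add: "(x + y :: 'a) ^ (q ^ i) = x ^ (q ^ i) + y ^ (q ^ i)"
  by (induction i arbitrary: x y) (simp_all add: power_q_add power_mult)

lemma frobenius_diff: "(x - y :: 'a) ^ (q ^ i) = x ^ (q ^ i) - y ^ (q ^ i)"
  using frobenius_add[of "x - y" y i] by (simp add: algebra_simps)

lemma power_q_diff: "(x - y :: 'a) ^ q = x ^ q - y ^ q"
  using frobenius_diff[of x y 1] by simp

lemma fixed_field_0: "(0 :: 'a) \<in> fixed_field (q ^ i)"
  and fixed_field_add: "x \<in> fixed_field (q ^ i) \<Longrightarrow> y \<in> fixed_field (q ^ i)
    \<Longrightarrow> x + y \<in> fixed_field (q ^ i)"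
  and fixed_field_diff: "x \<in> fixed_field (q ^ i) \<Longrightarrow> y \<in> fixed_field (q ^ i)
    \<Longrightarrow> x - y \<in> fixed_field (q ^ i)"
  and fixed_field_mult: "x \<in> fixed_field (q ^ i) \<Longrightarrow> y \<in> fixed_field (q ^ i)
    \<Longrightarrow> x * y \<in> fixed_field (q ^ i)"
  and fixed_field_divide: "x \<in> fixed_field (q ^ i) \<Longrightarrow> y \<in> fixed_field (q ^ i)
    \<Longrightarrow> x / y \<in> fixed_field (q ^ i)"
  for x y :: 'a
  using q_gt_1
  by (simp_all add: fixed_field_iff frobenius_add frobenius_diff power_mult_distrib power_divide)

lemma vec_power_add:
    "vec_power (q ^ i) (v + w) = vec_power (q ^ i) v + vec_power (q ^ i) w"
  and vec_power_diff:
    "vec_power (q ^ i) (v - w) = vec_power (q ^ i) v - vec_power (q ^ i) w"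
  for v w :: "'a ^ 'n"
  by (simp_all add: vec_eq_iff frobenius_add frobenius_diff)

end

section \<open>The algebra of a cubic polynomial\<close>

text \<open>Multiplication by \<open>t\<close> on \<open>R[t]/(t\<^sup>3 - c\<^sub>3 t\<^sup>2 - c\<^sub>2 t - c\<^sub>1)\<close> in the basis \<open>1, t, t\<^sup>2\<close>.\<close>

definition companion :: "'a::comm_ring_1 ^ 3 \<Rightarrow> 'a ^ 3 \<Rightarrow> 'a ^ 3" where
  "companion c v = vector [c $ 1 * v $ 3, v $ 1 + c $ 2 * v $ 3, v $ 2 + c $ 3 * v $ 3]"

lemma companion_nth [simp]:
  "companion c v $ 1 = c $ 1 * v $ 3"
  "companion c v $ 2 = v $ 1 + c $ 2 * v $ 3"
  "companion c v $ 3 = v $ 2 + c $ 3 * v $ 3"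
  by (simp_all add: companion_def)

lemma companion_0 [simp]: "companion c 0 = 0"
  and companion_add: "companion c (v + w) = companion c v + companion c w"
  and companion_scale: "companion c (k *s v) = k *s companion c v"
  by (simp_all add: vec_eq_iff forall_3 algebra_simps)

definition companion_mult :: "'a::comm_ring_1 ^ 3 \<Rightarrow> 'a ^ 3 \<Rightarrow> 'a ^ 3 \<Rightarrow> 'a ^ 3" where
  "companion_mult c y v
    = y $ 1 *s v + y $ 2 *s companion c v + y $ 3 *s companion c (companion c v)"

lemma companion_mult_0: "companion_mult c y 0 = 0"
  and companion_mult_add: "companion_mult c y (v + w) = companion_mult c y v + companion_mult c y w"
  and companion_mult_diff:
    "companion_mult c y (v - w) = companion_mult c y v - companion_mult c y w"
  and companion_mult_scale: "companion_mult c y (k *s v) = k *s companion_mult c y v"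
  and companion_mult_companion:
    "companion_mult c y (companion c v) = companion c (companion_mult c y v)"
  and companion_mult_diff_companion: "companion_mult c (y - k *s companion c y) v
    = companion_mult c y v - k *s companion c (companion_mult c y v)"
  by (simp_all add: companion_mult_def vec_eq_iff forall_3 algebra_simps)

lemma subspace_vimage_companion_mult:
  assumes "vec.subspace W"
  shows "vec.subspace {w. companion_mult c y w \<in> W}"
  using assms by (intro vec.subspaceI)
    (simp_all add: companion_mult_0 companion_mult_add companion_mult_scale
      vec.subspace_0 vec.subspace_add vec.subspace_scale)

lemma companion_mult_axis_1 [simp]:
  "companion_mult c (axis 1 1) v = v"
  "companion_mult c y (axis 1 1) = y"
  by (simp_all add: companion_mult_def vec_eq_iff forall_3 axis_def)

section \<open>Cubic polynomials without roots\<close>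

locale rootless_cubic = frobenius_field q "TYPE('a::field)" for q +
  fixes c :: "'a::field ^ 3"
  assumes coeff_fixed: "c $ j \<in> fixed_field q"
    and rootless: "x \<in> fixed_field q \<Longrightarrow> x ^ 3 \<noteq> c $ 1 + c $ 2 * x + c $ 3 * x\<^sup>2"
begin

lemma coeff_power: "c $ j ^ (q ^ i) = c $ j"
  using coeff_fixed[of j] by (induction i) (simp_all add: fixed_field_iff power_mult)

lemma vec_power_companion:
  "vec_power (q ^ i) (companion c v) = companion c (vec_power (q ^ i) v)"
  by (simp add: vec_eq_iff forall_3 frobenius_add power_mult_distrib coeff_power)

lemmas vec_power_q_add = vec_power_add[of 1, simplified]
  and vec_power_q_diff = vec_power_diff[of 1, simplified]
  and vec_power_q_companion = vec_power_companion[of 1, simplified]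

definition invariant_subspace :: "('a ^ 3) set \<Rightarrow> bool" where
  "invariant_subspace W \<longleftrightarrow> vec.subspace W \<and> (\<forall>w\<in>W. companion c w \<in> W \<and> vec_power q w \<in> W)"

lemma axis_1_mem_if_monic_linear_mem:
  assumes W: "invariant_subspace W" and u: "u \<in> W" "u $ 2 = 1" "u $ 3 = 0"
  shows "axis 1 1 \<in> W"
proof (cases "u $ 1 ^ q = u $ 1")
  case True
  define x where "x = - u $ 1"
  define y where "y = c $ 1 + c $ 2 * x + c $ 3 * x\<^sup>2 - x ^ 3"
  \<comment> \<open>division with remainder of the cubic by \<open>t - x\<close>\<close>
  have "y *s axis 1 1
      = companion c (companion c u) + (x - c $ 3) *s companion c u + (x\<^sup>2 - x * c $ 3 - c $ 2) *s u"
    by (simp add: vec_eq_iff forall_3 axis_def u x_def y_def algebra_simps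
        power2_eq_square power3_eq_cube)
  also have "\<dots> \<in> W"
    using W \<open>u \<in> W\<close> unfolding invariant_subspace_def
    by (intro vec.subspace_add vec.subspace_scale) auto
  finally have "y *s axis 1 1 \<in> W" .
  moreover have "x \<in> fixed_field q"
    using True power_q_diff[of 0 "u $ 1"] q_gt_1 by (simp add: fixed_field_iff x_def)
  hence "y \<noteq> 0"
    using rootless[of x] by (simp add: y_def)
  ultimately show ?thesis
    using W vec.mem_subspace_if_scale_mem unfolding invariant_subspace_def by blast
next
  case False
  have "vec_power q u - u = (u $ 1 ^ q - u $ 1) *s axis 1 1"
    using q_gt_1 by (simp add: vec_eq_iff forall_3 axis_def u)
  moreover have "vec_power q u - u \<in> W"
    using W u(1) by (simp add: invariant_subspace_def vec.subspace_diff)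
  ultimately have "(u $ 1 ^ q - u $ 1) *s axis 1 1 \<in> W"
    by simp
  thus ?thesis
    using W False vec.mem_subspace_if_scale_mem[of W "u $ 1 ^ q - u $ 1"]
    by (simp add: invariant_subspace_def)
qed

lemma axis_1_mem_if_linear_mem:
  assumes W: "invariant_subspace W" and w: "w \<in> W" "w \<noteq> 0" "w $ 3 = 0"
  shows "axis 1 1 \<in> W"
proof (cases "w $ 2 = 0")
  case True
  hence "w = w $ 1 *s axis 1 1" and "w $ 1 \<noteq> 0"
    using w by (auto simp: vec_eq_iff forall_3 axis_def)
  thus ?thesis
    using W w(1) vec.mem_subspace_if_scale_mem unfolding invariant_subspace_def by metis
next
  case False
  have "inverse (w $ 2) *s w \<in> W"
    using W w(1) by (simp add: invariant_subspace_def vec.subspace_scale)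
  thus ?thesis
    by (rule axis_1_mem_if_monic_linear_mem[OF W]) (use False w in simp_all)
qed

lemma axis_1_mem_if_invariant:
  assumes W: "invariant_subspace W" and w: "w \<in> W" "w \<noteq> 0"
  shows "axis 1 1 \<in> W"
proof (rule ccontr)
  assume not_mem: "axis 1 1 \<notin> W"
  have sub: "vec.subspace W"
    using W by (simp add: invariant_subspace_def)
  have eq_0: "v = 0" if "v \<in> W" "v $ 3 = 0" for v
    using axis_1_mem_if_linear_mem[OF W] not_mem that by blast
  hence "w $ 3 \<noteq> 0"
    using w by blast
  define u where "u = inverse (w $ 3) *s w"
  have u: "u \<in> W" "u $ 3 = 1"
    using \<open>w $ 3 \<noteq> 0\<close> vec.subspace_scale[OF sub w(1)] by (simp_all add: u_def)
  have "vec_power q u - u = 0"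
    using W u by (intro eq_0) (simp_all add: invariant_subspace_def vec.subspace_diff)
  hence "u $ 2 \<in> fixed_field q"
    by (simp add: vec_eq_iff fixed_field_iff)
  define x where "x = u $ 2 + c $ 3"
  have "companion c u - x *s u = 0"
    using W u by (intro eq_0)
      (simp_all add: invariant_subspace_def vec.subspace_diff vec.subspace_scale x_def)
  hence "c $ 1 = x * u $ 1" "u $ 1 + c $ 2 = x * u $ 2"
    using u(2) by (simp_all add: vec_eq_iff forall_3)
  moreover have "x ^ 3 = x * (x * u $ 2) + c $ 3 * x\<^sup>2"
    by (simp add: x_def algebra_simps power2_eq_square power3_eq_cube)
  ultimately have "x ^ 3 = c $ 1 + c $ 2 * x + c $ 3 * x\<^sup>2"
    by (metis distrib_left mult.commute)
  moreover have "x \<in> fixed_field q"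
    using fixed_field_add[of _ 1] \<open>u $ 2 \<in> fixed_field q\<close> coeff_fixed by (simp add: x_def)
  ultimately show False
    using rootless by blast
qed

lemma invariant_subspace_eq_UNIV:
  assumes W: "invariant_subspace W" and w: "w \<in> W" "w \<noteq> 0"
  shows "W = UNIV"
proof -
  have "axis 1 1 \<in> W"
    using assms by (rule axis_1_mem_if_invariant)
  moreover have "companion c (axis 1 1) = axis 2 1" "companion c (axis 2 1) = axis 3 1"
    by (simp_all add: vec_eq_iff forall_3 axis_def)
  ultimately have "axis j 1 \<in> W" for j
    using W exhaust_3[of j] unfolding invariant_subspace_def by metis
  hence "(\<Sum>j\<in>UNIV. v $ j *s axis j 1) \<in> W" for v
    using W by (intro vec.subspace_sum vec.subspace_scale) (simp_all add: invariant_subspace_def)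
  thus ?thesis
    unfolding basis_expansion by blast
qed

definition index_form :: "'a \<Rightarrow> 'a \<Rightarrow> 'a" where
  "index_form s t = s ^ 3 + 2 * c $ 3 * s\<^sup>2 * t + ((c $ 3)\<^sup>2 - c $ 2) * s * t\<^sup>2
    - (c $ 1 + c $ 2 * c $ 3) * t ^ 3"

lemma index_form_nonzero:
  assumes "s \<in> fixed_field q" and "t \<in> fixed_field q" and "s \<noteq> 0 \<or> t \<noteq> 0"
  shows "index_form s t \<noteq> 0"
proof (cases "t = 0")
  case True
  thus ?thesis
    using assms by (simp add: index_form_def)
next
  case False
  define x where "x = s / t + c $ 3"
  have "index_form s t = t ^ 3 * (x ^ 3 - (c $ 1 + c $ 2 * x + c $ 3 * x\<^sup>2))"
    using False by (simp add: index_form_def x_def field_simps power2_eq_square power3_eq_cube)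
  moreover have "x \<in> fixed_field q"
    unfolding x_def
    using fixed_field_add[of _ 1] fixed_field_divide[of _ 1] assms coeff_fixed by simp
  ultimately show ?thesis
    using False rootless[of x] by simp
qed

text \<open>A cubic field extension is generated by each of its elements outside the base field:
  eliminating \<open>t\<^sup>2\<close> from \<open>y\<close> and \<open>y\<^sup>2\<close> expresses \<open>t\<close> in terms of \<open>1, y, y\<^sup>2\<close>, with the index
  form of \<open>y\<close> as denominator.\<close>

lemma companion_mem_if_mult_invariant:
  assumes W: "vec.subspace W" and y: "\<And>j. y $ j \<in> fixed_field q" "y $ 2 \<noteq> 0 \<or> y $ 3 \<noteq> 0"
    and mult_W: "\<And>w. w \<in> W \<Longrightarrow> companion_mult c y w \<in> W" and w: "w \<in> W"
  shows "companion c w \<in> W"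
proof -
  define s t where "s = y $ 2" and "t = y $ 3"
  define S where "S v = companion_mult c y v - y $ 1 *s v" for v
  have S: "S v = s *s companion c v + t *s companion c (companion c v)" for v
    by (simp add: S_def companion_mult_def s_def t_def)
  have S_W: "S v \<in> W" if "v \<in> W" for v
    unfolding S_def using that by (intro vec.subspace_diff vec.subspace_scale W mult_W)
  have "index_form s t *s companion c w
      = (s\<^sup>2 + 2 * s * t * c $ 3 + t\<^sup>2 * (c $ 2 + (c $ 3)\<^sup>2)) *s S w
        - t *s S (S w) + (t\<^sup>2 * c $ 1 * (2 * s + t * c $ 3)) *s w"
    unfolding S index_form_def
    by (simp add: vec_eq_iff forall_3 algebra_simps power2_eq_square power3_eq_cube)
  also have "\<dots> \<in> W"
    using w by (intro vec.subspace_add vec.subspace_diff vec.subspace_scale W S_W)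
  finally have "index_form s t *s companion c w \<in> W" .
  moreover have "index_form s t \<noteq> 0"
    unfolding s_def t_def using y by (intro index_form_nonzero)
  ultimately show ?thesis
    by (rule vec.mem_subspace_if_scale_mem[OF W])
qed

lemma companion_mult_eq_0:
  assumes y: "\<And>j. y $ j \<in> fixed_field q" "y \<noteq> 0" and "companion_mult c y v = 0"
  shows "v = 0"
proof (rule ccontr)
  assume "v \<noteq> 0"
  define W where "W = {w. companion_mult c y w = 0}"
  have "invariant_subspace W"
    unfolding invariant_subspace_def
  proof (intro conjI ballI)
    show "vec.subspace W"
      using subspace_vimage_companion_mult[OF vec.subspace_single_0] by (simp add: W_def)
    fix w assume "w \<in> W"
    hence w: "companion_mult c y w = 0"
      by (simp add: W_def)
    thus "companion c w \<in> W"
      by (simp add: W_def companion_mult_companion)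
    have "companion_mult c y (vec_power q w) = vec_power q (companion_mult c y w)"
      using y(1)
      by (simp add: companion_mult_def fixed_field_iff vec_power_q_add vec_power_scale
          vec_power_q_companion)
    also have "\<dots> = 0"
      using w q_gt_1 by (simp add: vec_eq_iff)
    finally show "vec_power q w \<in> W"
      by (simp add: W_def)
  qed
  hence "axis 1 1 \<in> W"
    by (rule axis_1_mem_if_invariant[of W v]) (simp_all add: W_def assms(3) \<open>v \<noteq> 0\<close>)
  thus False
    using y(2) by (simp add: W_def)
qed

end

section \<open>Twisted norms\<close>

text \<open>The product of the \<open>1 - b^(q^j) t\<close> for \<open>j < i\<close>.\<close>

primrec twisted_norm :: "nat \<Rightarrow> 'a::comm_ring_1 ^ 3 \<Rightarrow> 'a \<Rightarrow> nat \<Rightarrow> 'a ^ 3" where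
  "twisted_norm q c b 0 = axis 1 1"
| "twisted_norm q c b (Suc i) =
    twisted_norm q c b i - b ^ (q ^ i) *s companion c (twisted_norm q c b i)"

definition generic_twisted_norm :: "nat \<Rightarrow> 'a::comm_ring_1 ^ 3 \<Rightarrow> nat \<Rightarrow> 'a poly ^ 3" where
  "generic_twisted_norm q c = twisted_norm q (\<chi> j. [:c $ j:]) (monom 1 1)"

lemma generic_twisted_norm_simps [simp]:
  "generic_twisted_norm q c 0 = axis 1 1"
  "generic_twisted_norm q c (Suc i) = generic_twisted_norm q c i
    - monom 1 (q ^ i) *s companion (\<chi> j. [:c $ j:]) (generic_twisted_norm q c i)"
  by (simp_all add: generic_twisted_norm_def monom_power)

lemma poly_generic_twisted_norm:
  "poly (generic_twisted_norm q c i $ j) b = twisted_norm q c b i $ j"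
proof -
  have "\<forall>j. poly (generic_twisted_norm q c i $ j) b = twisted_norm q c b i $ j"
    by (induction i) (simp_all add: forall_3 axis_def poly_monom)
  thus ?thesis ..
qed

lemma degree_companion_less:
  assumes "\<And>j. degree (v $ j) < d"
  shows "degree (companion (\<chi> j. [:c $ j:]) v $ j) < d"
proof -
  have "degree (smult (c $ j) (v $ 3)) < d" for j
    using assms le_less_trans[OF degree_smult_le] by blast
  hence "\<forall>j. degree (companion (\<chi> j. [:c $ j:]) v $ j) < d"
    using assms by (simp add: forall_3 degree_add_less)
  thus ?thesis ..
qed

lemma degree_generic_twisted_norm_less:
  assumes "1 < q"
  shows "degree (generic_twisted_norm q c i $ j) < q ^ i"
proof (induction i arbitrary: j)
  case (Suc i)
  define N where "N = generic_twisted_norm q c i"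
  have "q ^ i + q ^ i \<le> q ^ Suc i"
    using assms by (simp flip: mult_2)
  moreover have "degree (monom 1 (q ^ i) * companion (\<chi> j. [:c $ j:]) N $ j) < q ^ i + q ^ i"
    unfolding N_def
    by (intro le_less_trans[OF degree_mult_le] add_le_less_mono degree_monom_le
        degree_companion_less Suc)
  moreover have "degree (N $ j) < q ^ i"
    unfolding N_def by (rule Suc)
  ultimately have "degree (N $ j - monom 1 (q ^ i) * companion (\<chi> j. [:c $ j:]) N $ j) < q ^ Suc i"
    by (intro degree_diff_less) linarith+
  thus ?case
    by (simp add: N_def)
qed (simp add: axis_def)

lemma coeff_generic_twisted_norm:
  assumes "1 < q"
  shows "poly.coeff (generic_twisted_norm q c (Suc i) $ 2) 1 = - 1"
proof (induction i)
  case 0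
  show ?case
    by (simp add: axis_def)
next
  case (Suc i)
  moreover have "1 < q ^ Suc i"
    using assms by (rule one_less_power) simp
  ultimately show ?case
    by (simp add: coeff_monom_mult)
qed

lemma ex_twisted_norm_nonscalar:
  fixes c :: "'a::idom ^ 3"
  assumes "1 < q" and "0 < n" and "q ^ n \<le> card B"
  obtains b where "b \<in> B" and "twisted_norm q c b n $ 2 \<noteq> 0"
proof -
  define p where "p = generic_twisted_norm q c n $ 2"
  have "poly.coeff p 1 = - 1"
    using coeff_generic_twisted_norm[OF assms(1)] assms(2)
    unfolding p_def by (metis gr0_implies_Suc)
  hence "p \<noteq> 0"
    by auto
  moreover have "degree p < card B"
    using degree_generic_twisted_norm_less[OF assms(1)] assms(3)
    unfolding p_def by (rule less_le_trans)
  ultimately obtain b where "b \<in> B" "poly p b \<noteq> 0"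
    using poly_eqI_degree[of B p 0] by fastforce
  thus thesis
    using that by (simp add: p_def poly_generic_twisted_norm)
qed

context rootless_cubic
begin

definition twisted :: "'a \<Rightarrow> 'a ^ 3 \<Rightarrow> 'a ^ 3" where
  "twisted b v = vec_power q v - b *s companion c (vec_power q v)"

lemma twisted_add: "twisted b (v + w) = twisted b v + twisted b w"
  by (simp add: twisted_def vec_eq_iff forall_3 power_q_add algebra_simps)

lemma twisted_scale: "twisted b (k *s v) = k ^ q *s twisted b v"
  by (simp add: twisted_def vec_eq_iff forall_3 algebra_simps)

lemma twisted_0: "twisted b 0 = 0"
  using twisted_scale[of b 0 0] q_gt_1 by (simp add: power_0_left)

lemma subspace_vimage_twisted:
  assumes "vec.subspace W"
  shows "vec.subspace {w. twisted b w \<in> W}"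
  using assms by (intro vec.subspaceI)
    (simp_all add: twisted_0 twisted_add twisted_scale
      vec.subspace_0 vec.subspace_add vec.subspace_scale)

lemma vec_power_twisted: "vec_power (q ^ i) (twisted b v)
    = vec_power (q ^ Suc i) v - b ^ (q ^ i) *s companion c (vec_power (q ^ Suc i) v)"
  by (simp add: twisted_def vec_power_diff vec_power_scale vec_power_companion)
    (simp add: vec_power_def power_mult)

lemma funpow_twisted:
  "(twisted b ^^ i) v = companion_mult c (twisted_norm q c b i) (vec_power (q ^ i) v)"
proof (induction i arbitrary: v)
  case 0
  show ?case
    by (simp add: vec_eq_iff)
next
  case (Suc i)
  have "(twisted b ^^ Suc i) v = (twisted b ^^ i) (twisted b v)"
    by (simp add: funpow_swap1)
  thus ?case
    by (simp add: Suc vec_power_twisted companion_mult_diff companion_mult_scale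
        companion_mult_companion companion_mult_diff_companion)
qed

lemma twisted_norm_Suc: "twisted b (twisted_norm q c b i) = twisted_norm q c b (Suc i)"
proof -
  have "vec_power Q (axis 1 1) = (axis 1 1 :: 'a ^ 3)" if "0 < Q" for Q
    using that by (simp add: vec_eq_iff axis_def)
  hence "(twisted b ^^ i) (axis 1 1) = twisted_norm q c b i" for i
    using q_gt_1 by (simp add: funpow_twisted)
  thus ?thesis
    by (metis funpow.simps(2) comp_apply)
qed

end

locale nonscalar_twisted_norm = rootless_cubic q c for q and c :: "'a::field ^ 3" +
  fixes n :: nat and b :: 'a
  assumes n_pos: "0 < n"
    and b_fixed: "b \<in> fixed_field (q ^ n)"
    and \<nu>_nonscalar: "twisted_norm q c b n $ 2 \<noteq> 0"
begin

abbreviation \<nu> :: "'a ^ 3" where "\<nu> \<equiv> twisted_norm q c b n"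

lemma twisted_fixed:
  assumes "vec_power (q ^ n) v = v"
  shows "vec_power (q ^ n) (twisted b v) = twisted b v"
proof -
  have "vec_power (q ^ Suc n) v = vec_power q v"
    using assms by (metis vec_power_vec_power power_Suc2)
  thus ?thesis
    using b_fixed vec_power_twisted[of n b v] by (simp add: fixed_field_iff twisted_def)
qed

lemma \<nu>_fixed: "\<nu> $ j \<in> fixed_field q"
proof -
  obtain m where m: "n = Suc m"
    using n_pos gr0_implies_Suc by blast
  have "vec_power q \<nu> = vec_power q (twisted_norm q c b m)
      - (b ^ q ^ m) ^ q *s companion c (vec_power q (twisted_norm q c b m))"
    by (simp add: m vec_power_q_diff vec_power_scale vec_power_q_companion)
  also have "(b ^ q ^ m) ^ q = b"
    using b_fixed by (simp add: fixed_field_iff m mult.commute flip: power_mult)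
  also have "vec_power q (twisted_norm q c b m)
      - b *s companion c (vec_power q (twisted_norm q c b m)) = \<nu>"
    using twisted_norm_Suc[of b m] by (simp add: twisted_def m)
  finally show ?thesis
    by (simp add: fixed_field_iff flip: vec_power_nth)
qed

lemma diff_companion_eq_0_imp_eq_0:
  assumes "v - b *s companion c v = 0"
  shows "v = 0"
proof -
  have "companion_mult c (twisted_norm q c b (Suc i)) v = 0" for i
  proof (induction i)
    case 0
    show ?case
      using assms by (simp add: companion_mult_diff_companion del: right_minus_eq)
  next
    case (Suc i)
    show ?case
      unfolding twisted_norm.simps(2)[of q c b "Suc i"] companion_mult_diff_companion Suc by simp
  qed
  hence "companion_mult c \<nu> v = 0"
    using n_pos by (metis gr0_implies_Suc)
  thus ?thesis
    using companion_mult_eq_0 \<nu>_fixed \<nu>_nonscalar by fastforce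
qed

lemma mem_if_diff_companion_mem:
  assumes W: "vec.subspace W" "\<And>w. w \<in> W \<Longrightarrow> companion c w \<in> W"
    and v: "v - b *s companion c v \<in> W"
  shows "v \<in> W"
proof -
  define h where "h v = v - b *s companion c v" for v
  have h: "Vector_Spaces.linear (*s) (*s) h"
    by unfold_locales (simp_all add: h_def companion_add companion_scale vec_eq_iff algebra_simps)
  have "inj h"
  proof (rule injI)
    fix u w assume "h u = h w"
    hence "h (u - w) = 0"
      by (simp add: vec.linear_diff[OF h])
    thus "u = w"
      using diff_companion_eq_0_imp_eq_0[of "u - w"] by (simp add: h_def)
  qed
  moreover have "h ` W \<subseteq> W"
    using W by (auto simp: h_def vec.subspace_diff vec.subspace_scale)
  ultimately have "h ` W = W"
    using vec.inj_linear_image_subspace_eq[OF h _ W(1)] by blast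
  thus ?thesis
    using v \<open>inj h\<close> by (metis h_def imageE injD)
qed

lemma span_twisted_invariant:
  assumes x: "vec_power (q ^ n) x = x"
    and twisted_twisted: "twisted b (twisted b x) \<in> vec.span {x, twisted b x}"
  shows "invariant_subspace (vec.span {x, twisted b x})"
proof -
  define W where "W = vec.span {x, twisted b x}"
  have W: "vec.subspace W"
    by (simp add: W_def)
  have "W \<subseteq> {w. twisted b w \<in> W}"
    unfolding W_def
    by (intro vec.span_minimal subspace_vimage_twisted)
      (simp_all add: twisted_twisted vec.span_base)
  hence twisted_W: "twisted b w \<in> W" if "w \<in> W" for w
    using that by blast
  have funpow_W: "(twisted b ^^ i) w \<in> W" if "w \<in> W" for i w
    by (induction i) (simp_all add: twisted_W that)
  have "companion_mult c \<nu> w \<in> W" if "w \<in> {x, twisted b x}" for w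
  proof -
    have "w \<in> W"
      unfolding W_def using that by (rule vec.span_base)
    moreover have "vec_power (q ^ n) w = w"
      using that x twisted_fixed by blast
    ultimately show ?thesis
      using funpow_W[of w n] by (simp add: funpow_twisted)
  qed
  hence "W \<subseteq> {w. companion_mult c \<nu> w \<in> W}"
    unfolding W_def by (intro vec.span_minimal subspace_vimage_companion_mult) auto
  hence companion_W: "companion c w \<in> W" if "w \<in> W" for w
    using companion_mem_if_mult_invariant[OF W \<nu>_fixed] \<nu>_nonscalar that by blast
  have "vec_power q w \<in> W" if "w \<in> W" for w
    by (rule mem_if_diff_companion_mem[OF W companion_W])
      (use twisted_W[OF that] in \<open>simp_all add: twisted_def\<close>)
  thus ?thesis
    using W companion_W by (simp add: invariant_subspace_def flip: W_def)
qed

lemma twisted_twisted_not_in_span: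
  assumes "vec_power (q ^ n) x = x" and "x \<noteq> 0"
  shows "twisted b (twisted b x) \<notin> vec.span {x, twisted b x}"
proof
  assume "twisted b (twisted b x) \<in> vec.span {x, twisted b x}"
  hence "invariant_subspace (vec.span {x, twisted b x})"
    using assms(1) by (rule span_twisted_invariant[rotated])
  hence "vec.span {x, twisted b x} = UNIV"
    using assms(2) by (intro invariant_subspace_eq_UNIV[of _ x]) (simp_all add: vec.span_base)
  hence "CARD(3) = vec.dim {x, twisted b x}"
    by (metis vec_dim_card vec.dim_span)
  also have "\<dots> \<le> card {x, twisted b x}"
    by (rule vec.dim_le_card') simp
  also have "\<dots> \<le> 2"
    by (simp add: card_insert_if)
  finally show False
    by simp
qed

end

section \<open>The scattered linear set\<close>

locale field_tower =
  fixes n q :: nat and \<iota> :: "'q::{field,finite} \<Rightarrow> 'a::{field,finite}"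
  assumes n_pos: "0 < n" and primepow_q: "primepow q"
    and card_q: "CARD('q) = q" and card_a: "CARD('a) = q ^ (2 * n)"
    and embedding: "field_embedding \<iota>"

sublocale field_tower \<subseteq> frobenius_field q "TYPE('a)"
proof
  show "1 < q"
    using primepow_q primepow_gt_Suc_0 by fastforce
  show "(x + y) ^ q = x ^ q + y ^ q" for x y :: 'a
    using primepow_q card_a by (rule primepow_power_add)
qed

context field_tower
begin

abbreviation K :: "'a set" where "K \<equiv> fixed_field (q ^ n)"

abbreviation V :: "('a ^ 3) set" where "V \<equiv> {v. \<forall>j. v $ j \<in> K}"

lemma card_K: "card K = q ^ n"
proof (rule card_fixed_field_of_square)
  show "1 < q ^ n"
    using q_gt_1 n_pos by (rule one_less_power)
  show "CARD('a) = (q ^ n)\<^sup>2"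
    by (simp add: card_a mult.commute flip: power_mult)
qed (rule frobenius_add)

lemma card_V: "card V = q ^ (3 * n)"
  using card_vec_components[of K, where ?'n = 3]
  by (simp add: card_K mult.commute flip: power_mult)

lemma \<iota>_1: "\<iota> 1 = 1"
  and \<iota>_add: "\<iota> (x + y) = \<iota> x + \<iota> y"
  and \<iota>_mult: "\<iota> (x * y) = \<iota> x * \<iota> y"
  using embedding by (auto simp: field_embedding_def)

lemma \<iota>_power: "\<iota> (x ^ m) = \<iota> x ^ m"
  by (induction m) (simp_all add: \<iota>_1 \<iota>_mult)

lemma inj_\<iota>: "inj \<iota>"
proof (rule injI, rule ccontr)
  fix x y assume eq: "\<iota> x = \<iota> y" and "x \<noteq> y"
  have "\<iota> (x - y) + \<iota> y = \<iota> x"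
    by (simp flip: \<iota>_add)
  hence "\<iota> (x - y) * \<iota> (inverse (x - y)) = 0"
    using eq by simp
  thus False
    using \<open>x \<noteq> y\<close> by (simp add: \<iota>_1 flip: \<iota>_mult)
qed

lemma range_\<iota>: "range \<iota> = fixed_field q"
proof (rule card_seteq)
  show "range \<iota> \<subseteq> fixed_field q"
    using power_card_eq_self[where ?'a = 'q]
    by (auto simp: fixed_field_iff card_q simp flip: \<iota>_power)
  show "card (fixed_field q :: 'a set) \<le> card (range \<iota>)"
    using card_fixed_field_le[OF q_gt_1, where ?'a = 'a] by (simp add: card_image inj_\<iota> card_q)
qed simp

lemma \<iota>_fixed: "\<iota> c ^ (q ^ i) = \<iota> c"
proof (induction i)
  case (Suc i)
  have "\<iota> c ^ q = \<iota> c"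
    using range_\<iota> fixed_field_iff by blast
  thus ?case
    by (simp add: power_mult Suc)
qed simp

lemma ex_rootless_cubic:
  obtains c :: "'a ^ 3" where "rootless_cubic q c"
proof -
  obtain c0 c1 c2 :: 'q where no_root: "\<And>x. x ^ 3 \<noteq> c0 + c1 * x + c2 * x\<^sup>2"
    using ex_cubic_without_root by blast
  define c :: "'a ^ 3" where "c = vector [\<iota> c0, \<iota> c1, \<iota> c2]"
  have "rootless_cubic q c"
  proof
    show "c $ j \<in> fixed_field q" for j
      using exhaust_3[of j] by (auto simp: c_def simp flip: range_\<iota>)
  next
    fix x :: 'a assume "x \<in> fixed_field q"
    then obtain y where x: "x = \<iota> y"
      using range_\<iota> by blast
    have "\<iota> (y ^ 3) \<noteq> \<iota> (c0 + c1 * y + c2 * y\<^sup>2)"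
      using no_root inj_\<iota> by (simp add: inj_eq)
    thus "x ^ 3 \<noteq> c $ 1 + c $ 2 * x + c $ 3 * x\<^sup>2"
      by (simp add: x c_def \<iota>_add \<iota>_mult \<iota>_power)
  qed
  thus thesis
    by (rule that)
qed

lemma ex_nonscalar_twisted_norm:
  obtains c :: "'a ^ 3" and b where "nonscalar_twisted_norm q c n b"
proof -
  obtain c :: "'a ^ 3" where c: "rootless_cubic q c"
    by (rule ex_rootless_cubic)
  obtain b where "b \<in> K" "twisted_norm q c b n $ 2 \<noteq> 0"
    using ex_twisted_norm_nonscalar[OF q_gt_1 n_pos] card_K by (metis order_refl)
  hence "nonscalar_twisted_norm q c n b"
    using c n_pos by (simp add: nonscalar_twisted_norm_def nonscalar_twisted_norm_axioms_def)
  thus thesis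
    by (rule that)
qed

lemma ex_not_in_K: "\<exists>\<omega>. \<omega> \<notin> K"
proof (rule ccontr)
  assume "\<not> ?thesis"
  hence "K = UNIV"
    by blast
  thus False
    using card_K card_a q_gt_1 n_pos by simp
qed

lemma K_coordinates_unique:
  assumes "\<omega> \<notin> K" "a \<in> K" "b \<in> K" "c \<in> K" "d \<in> K" and eq: "a + b * \<omega> = c + d * \<omega>"
  shows "a = c \<and> b = d"
proof -
  have "b = d"
  proof (rule ccontr)
    assume "b \<noteq> d"
    hence "\<omega> = (c - a) / (b - d)"
      using eq by (simp add: field_simps)
    thus False
      using assms by (simp add: fixed_field_diff fixed_field_divide)
  qed
  thus ?thesis
    using eq by simp
qed

lemma K_coordinates_exist:
  assumes "\<omega> \<notin> K"
  obtains a b where "a \<in> K" "b \<in> K" "x = a + b * \<omega>"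
proof -
  define g where "g = (\<lambda>(a, b). a + b * \<omega>)"
  have "inj_on g (K \<times> K)"
    using K_coordinates_unique[OF assms] by (auto simp: inj_on_def g_def)
  hence "card (g ` (K \<times> K)) = CARD('a)"
    by (simp add: card_image card_cartesian_product card_K card_a power_add mult_2)
  hence "g ` (K \<times> K) = UNIV"
    by (simp add: card_eq_UNIV_imp_eq_UNIV)
  hence "x \<in> g ` (K \<times> K)"
    by blast
  thus thesis
    using that by (auto simp: g_def)
qed

lemma V_coordinates_unique:
  assumes "\<omega> \<notin> K" "v \<in> V" "w \<in> V" "v' \<in> V" "w' \<in> V" and eq: "v + \<omega> *s w = v' + \<omega> *s w'"
  shows "v = v' \<and> w = w'"
proof -
  have "v $ j = v' $ j \<and> w $ j = w' $ j" for j
  proof (rule K_coordinates_unique[OF assms(1)])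
    show "v $ j + w $ j * \<omega> = v' $ j + w' $ j * \<omega>"
      using arg_cong[OF eq, of "\<lambda>u. u $ j"] by (simp add: mult.commute)
  qed (use assms in auto)
  thus ?thesis
    by (simp add: vec_eq_iff)
qed

end

locale semilinear_graph = field_tower n q \<iota>
  for n q and \<iota> :: "'q::{field,finite} \<Rightarrow> 'a::{field,finite}" +
  fixes \<omega> :: 'a and f :: "'a ^ 3 \<Rightarrow> 'a ^ 3"
  assumes \<omega>_not_in_K: "\<omega> \<notin> K"
    and f_V: "x \<in> V \<Longrightarrow> f x \<in> V"
    and f_add: "f (x + y) = f x + f y"
    and f_scale: "f (k *s x) = k ^ q *s f x"
    and not_in_span: "x \<in> V \<Longrightarrow> x \<noteq> 0 \<Longrightarrow> f (f x) \<notin> vec.span {x, f x}"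
begin

definition graph_map :: "'a ^ 3 \<Rightarrow> 'a ^ 3" where
  "graph_map x = f x + \<omega> *s x"

definition U :: "('a ^ 3) set" where
  "U = graph_map ` V"

sublocale base: vector_space "sub_scale \<iota>"
  by (rule vector_space_sub_scale) (rule embedding)

lemma f_0: "f 0 = 0"
  using f_scale[of 0 0] q_gt_1 by (simp add: power_0_left)

lemma f_nonzero: "x \<in> V \<Longrightarrow> x \<noteq> 0 \<Longrightarrow> f x \<noteq> 0"
  using not_in_span[of x] f_0 vec.span_zero by fastforce

lemma graph_map_0: "graph_map 0 = 0"
  by (simp add: graph_map_def f_0)

lemma graph_map_add: "graph_map (x + y) = graph_map x + graph_map y"
  by (simp add: graph_map_def f_add vector_add_ldistrib)

lemma graph_map_scale: "graph_map (\<iota> k *s x) = \<iota> k *s graph_map x"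
  using \<iota>_fixed[of k 1]
  by (simp add: graph_map_def f_scale vector_add_ldistrib vector_smult_assoc mult.commute)

lemma inj_on_graph_map: "inj_on graph_map V"
  using V_coordinates_unique[OF \<omega>_not_in_K] f_V unfolding graph_map_def by (intro inj_onI) blast

lemma subspace_U: "base.subspace U"
proof (rule base.subspaceI)
  show "0 \<in> U"
    unfolding U_def using fixed_field_0 by (intro image_eqI[of _ _ 0]) (simp_all add: graph_map_0)
next
  fix u v assume "u \<in> U" "v \<in> U"
  then obtain x y where "x \<in> V" "u = graph_map x" "y \<in> V" "v = graph_map y"
    unfolding U_def by blast
  thus "u + v \<in> U"
    unfolding U_def
    by (intro image_eqI[of _ _ "x + y"]) (simp_all add: graph_map_add fixed_field_add)
next
  fix k u assume "u \<in> U"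
  then obtain x where "x \<in> V" "u = graph_map x"
    unfolding U_def by blast
  moreover have "\<iota> k \<in> K"
    by (simp add: fixed_field_iff \<iota>_fixed)
  ultimately show "sub_scale \<iota> k u \<in> U"
    unfolding U_def
    by (intro image_eqI[of _ _ "\<iota> k *s x"])
      (simp_all add: graph_map_scale sub_scale_def fixed_field_mult)
qed

lemma dim_U: "base.dim U = 3 * n"
proof -
  have "q ^ base.dim U = q ^ (3 * n)"
    using base.card_subspace_eq_power_dim[OF subspace_U]
    by (simp add: card_q U_def card_image inj_on_graph_map card_V)
  thus ?thesis
    using q_gt_1 by simp
qed

lemma graph_map_multiple:
  assumes x: "x \<in> V" and y: "y \<in> V" and AB: "A \<in> K" "B \<in> K"
    and eq: "(A + B * \<omega>) *s graph_map x = graph_map y"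
  obtains C D where "y = C *s x + B *s f x" and "f y = A *s f x + D *s x"
    and "B = 0 \<Longrightarrow> C = A \<and> D = 0"
proof -
  obtain s t where st: "s \<in> K" "t \<in> K" "\<omega> * \<omega> = s + t * \<omega>"
    using K_coordinates_exist[OF \<omega>_not_in_K] by blast
  have "(A + B * \<omega>) * (f x $ j + \<omega> * x $ j)
      = A * f x $ j + (\<omega> * \<omega>) * B * x $ j + \<omega> * (A * x $ j + B * f x $ j)" for j
    by (simp add: algebra_simps)
  hence "(A + B * \<omega>) *s graph_map x
      = (A *s f x + (s * B) *s x) + \<omega> *s ((A + t * B) *s x + B *s f x)"
    unfolding st(3) by (simp add: graph_map_def vec_eq_iff algebra_simps)
  hence "f y + \<omega> *s y = (A *s f x + (s * B) *s x) + \<omega> *s ((A + t * B) *s x + B *s f x)"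
    using eq by (simp add: graph_map_def)
  moreover have "A *s f x + (s * B) *s x \<in> V" "(A + t * B) *s x + B *s f x \<in> V"
    using AB st x f_V[OF x] by (simp_all add: fixed_field_add fixed_field_mult)
  ultimately have coordinates: "f y = A *s f x + (s * B) *s x \<and> y = (A + t * B) *s x + B *s f x"
    using f_V[OF y] y \<omega>_not_in_K by (intro V_coordinates_unique)
  show thesis
    by (rule that[OF conjunct2[OF coordinates] conjunct1[OF coordinates]]) simp
qed

lemma multiplier_in_base_field:
  assumes x: "x \<in> V" "x \<noteq> 0" and y: "y \<in> V" and eq: "l *s graph_map x = graph_map y"
  shows "l \<in> range \<iota>"
proof -
  obtain A B where AB: "A \<in> K" "B \<in> K" "l = A + B * \<omega>"
    by (rule K_coordinates_exist[OF \<omega>_not_in_K])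
  obtain C D where CD: "y = C *s x + B *s f x" "f y = A *s f x + D *s x" "B = 0 \<Longrightarrow> C = A \<and> D = 0"
    using graph_map_multiple[OF x(1) y AB(1,2)] eq AB(3) by metis
  have "f y = C ^ q *s f x + B ^ q *s f (f x)"
    unfolding CD(1) by (simp add: f_add f_scale)
  hence relation: "B ^ q *s f (f x) = D *s x + (A - C ^ q) *s f x"
    unfolding CD(2) by (simp add: algebra_simps)
  have "B = 0"
  proof (rule ccontr)
    assume "B \<noteq> 0"
    have "B ^ q *s f (f x) \<in> vec.span {x, f x}"
      unfolding relation by (intro vec.span_add vec.span_scale vec.span_base) simp_all
    hence "f (f x) \<in> vec.span {x, f x}"
      by (rule vec.mem_subspace_if_scale_mem[OF vec.subspace_span]) (simp add: \<open>B \<noteq> 0\<close>)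
    thus False
      using not_in_span x by blast
  qed
  hence "(A - A ^ q) *s f x = 0"
    using relation CD(3) q_gt_1 by (simp add: power_0_left)
  hence "A ^ q = A"
    using f_nonzero[OF x] by simp
  thus ?thesis
    using \<open>B = 0\<close> by (simp add: AB(3) range_\<iota> fixed_field_iff)
qed

lemma dim_U_Int_point:
  assumes "P \<in> linear_set U"
  shows "base.dim (U \<inter> P) = 1"
proof -
  obtain u where u: "u \<in> U" "u \<noteq> 0" "P = vec.span {u}"
    using assms by (auto simp: linear_set_def)
  then obtain x where x: "x \<in> V" "u = graph_map x"
    unfolding U_def by blast
  have "x \<noteq> 0"
    using u(2) x(2) graph_map_0 by auto
  have "U \<inter> P = base.span {u}"
  proof
    show "U \<inter> P \<subseteq> base.span {u}"
    proof
      fix w assume "w \<in> U \<inter> P"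
      then obtain l y where l: "w = l *s u" and y: "y \<in> V" "w = graph_map y"
        unfolding u(3) U_def by (auto simp: vec.span_singleton simp del: mem_Collect_eq)
      hence "l \<in> range \<iota>"
        using multiplier_in_base_field[OF x(1) \<open>x \<noteq> 0\<close> y(1)] x(2) by simp
      thus "w \<in> base.span {u}"
        unfolding base.span_singleton by (auto simp: l sub_scale_def)
    qed
    show "base.span {u} \<subseteq> U \<inter> P"
      using base.subspace_scale[OF subspace_U u(1)]
      by (auto simp: base.span_singleton vec.span_singleton u(3) sub_scale_def)
  qed
  moreover have "base.independent {u}"
    using u(2) by (simp add: base.independent_insert)
  ultimately show ?thesis
    by (simp add: base.dim_eq_card_independent)
qed

lemma scattered: "scattered_linear_set \<iota> (3 * n) (linear_set U)"
  unfolding scattered_linear_set_def using subspace_U dim_U dim_U_Int_point by blast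

end

lemma (in field_tower) ex_scattered: "\<exists>L. scattered_linear_set \<iota> (3 * n) L"
proof -
  obtain \<omega> where "\<omega> \<notin> K"
    using ex_not_in_K by blast
  obtain c :: "'a ^ 3" and b where "nonscalar_twisted_norm q c n b"
    by (rule ex_nonscalar_twisted_norm)
  then interpret nonscalar_twisted_norm q c n b .
  have V_iff: "v \<in> V \<longleftrightarrow> vec_power (q ^ n) v = v" for v
    by (simp add: fixed_field_iff vec_eq_iff)
  interpret semilinear_graph n q \<iota> \<omega> "twisted b"
  proof
    show "\<omega> \<notin> K"
      by fact
  qed (simp_all only: V_iff twisted_fixed twisted_add twisted_scale
      twisted_twisted_not_in_span not_False_eq_True)
  show ?thesis
    using scattered by blast
qed

theorem theorem2p5:
  fixes n q :: nat
    and \<iota> :: "'q::{field,finite} \<Rightarrow> 'a::{field,finite}"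
  assumes "n \<ge> 2"
    and "primepow q"
    and "CARD('q) = q"
    and "CARD('a) = q ^ (2 * n)"
    and "field_embedding \<iota>"
  shows "(\<not> [n = 0] (mod 3) \<longrightarrow> (\<exists>L. scattered_linear_set \<iota> (3 * n) L)) \<and>
         ([n = 0] (mod 3) \<longrightarrow> [q = 1] (mod 3) \<longrightarrow> (\<exists>L. scattered_linear_set \<iota> (3 * n) L))"
proof -
  interpret field_tower n q \<iota>
    using assms by unfold_locales auto
  show ?thesis
    using ex_scattered by blast
qed

end
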